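(* For each integer $n\ge1$ the function $\dim_U\colon\mathcal{K}(\mathbb{R}^n)\to[0,n]$ is not Borel.
   Context: $\mathcal{K}(\mathbb{R}^n)$ is the set of non-empty compact subsets of $\mathbb{R}^n$ endowed with the Hausdorff metric. $|E|$ denotes the diameter of a set $E$. $\mathcal{D}$ is the family of all sets $D\subset(0,\infty)$ with $\inf D=0$ that are open in the Sorgenfrey topology (generated by the intervals $[a,b)$), i.e. for every $t\in D$ there is $\delta>0$ with $[t,t+\delta)\subset D$. For $D\in\mathcal{D}$, $E\subset\mathbb{R}^n$ and $s\ge0$ let $$\mathcal{H}^s_{D,\infty}(E)=\inf\left\{\sum_{i=1}^\infty|E_i|^s: E\subset\bigcup_{i=1}^\infty E_i,\ |E_i|\in D\text{ for all }i\right\},\qquad \dim_H^D E=\inf\{s\ge0:\mathcal{H}^s_{D,\infty}(E)=0\}.$$ The universal restricted Hausdorff dimension is $\dim_U E=\sup\{\dim_H^D E: D\in\mathcal{D}\}$. *)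

theory Defs
  imports "HOL-Analysis.Analysis"
begin

definition nonempty_compacts :: "'a::metric_space set set" where
  "nonempty_compacts = {A. compact A \<and> A \<noteq> {}}"

text \<open>
  The locale \<open>Metric_space\<close> asks for nonnegativity and symmetry on the whole type, hence the
  totalisation by 0 outside the carrier.
\<close>

definition hausdorff_dist :: "'a::metric_space set \<Rightarrow> 'a set \<Rightarrow> real" where
  "hausdorff_dist A B =
    (if A \<in> nonempty_compacts \<and> B \<in> nonempty_compacts
     then max (SUP a\<in>A. infdist a B) (SUP b\<in>B. infdist b A) else 0)"

lemma hausdorff_dist_le_iff:
  assumes "A \<in> nonempty_compacts" "B \<in> nonempty_compacts"
  shows "hausdorff_dist A B \<le> r \<longleftrightarrow> (\<forall>a\<in>A. infdist a B \<le> r) \<and> (\<forall>b\<in>B. infdist b A \<le> r)"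
proof -
  have bdd: "bdd_above ((\<lambda>a. infdist a T) ` S)" if "S \<in> nonempty_compacts" for S T :: "'a set"
  proof -
    have "continuous_on S (\<lambda>a. infdist a T)"
      by (intro continuous_on_infdist continuous_on_id)
    then have "compact ((\<lambda>a. infdist a T) ` S)"
      using that by (intro compact_continuous_image) (auto simp: nonempty_compacts_def)
    then show ?thesis
      by (intro bounded_imp_bdd_above compact_imp_bounded)
  qed
  have "(SUP a\<in>S. infdist a T) \<le> r \<longleftrightarrow> (\<forall>a\<in>S. infdist a T \<le> r)"
    if "S \<in> nonempty_compacts" for S T :: "'a set"
    using that bdd[OF that] by (subst cSUP_le_iff) (auto simp: nonempty_compacts_def)
  then show ?thesis
    using assms by (simp add: hausdorff_dist_def)
qed

lemma Metric_space_hausdorff: "Metric_space nonempty_compacts hausdorff_dist"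
proof
  fix A B :: "'a set"
  show "hausdorff_dist A B = hausdorff_dist B A"
    by (auto simp: hausdorff_dist_def max.commute)
  show "0 \<le> hausdorff_dist A B"
  proof (cases "A \<in> nonempty_compacts \<and> B \<in> nonempty_compacts")
    case True
    then obtain a where "a \<in> A" by (auto simp: nonempty_compacts_def)
    then have "infdist a B \<le> hausdorff_dist A B"
      using True hausdorff_dist_le_iff by blast
    then show ?thesis using infdist_nonneg[of a B] by linarith
  next
    case False
    then show ?thesis unfolding hausdorff_dist_def by (subst if_not_P) auto
  qed
next
  fix A B :: "'a set"
  assume AB: "A \<in> nonempty_compacts" "B \<in> nonempty_compacts"
  show "hausdorff_dist A B = 0 \<longleftrightarrow> A = B"
  proof
    assume "hausdorff_dist A B = 0"
    then have "\<forall>a\<in>A. infdist a B \<le> 0" "\<forall>b\<in>B. infdist b A \<le> 0"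
      using hausdorff_dist_le_iff[OF AB, of 0] by auto
    then have "\<forall>a\<in>A. infdist a B = 0" "\<forall>b\<in>B. infdist b A = 0"
      by (simp_all add: order_antisym infdist_nonneg)
    moreover have "closed A" "closed B" "A \<noteq> {}" "B \<noteq> {}"
      using AB by (auto simp: nonempty_compacts_def compact_imp_closed)
    ultimately show "A = B"
      using in_closed_iff_infdist_zero by blast
  next
    assume "A = B"
    then show "hausdorff_dist A B = 0"
      using AB by (simp add: hausdorff_dist_def nonempty_compacts_def)
  qed
next
  fix A B C :: "'a set"
  assume K: "A \<in> nonempty_compacts" "B \<in> nonempty_compacts" "C \<in> nonempty_compacts"
  have tri: "infdist x T \<le> r + s"
    if x: "infdist x S \<le> r" and S: "\<And>y. y \<in> S \<Longrightarrow> infdist y T \<le> s" and ne: "S \<noteq> {}"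
    for x r s and S T :: "'a set"
  proof (rule field_le_epsilon)
    fix e :: real assume "e > 0"
    have "(INF y\<in>S. dist x y) < r + e"
      using x ne \<open>e > 0\<close> by (simp add: infdist_notempty)
    then obtain y where "y \<in> S" "dist x y < r + e"
      using ne by (auto simp: cINF_less_iff)
    then show "infdist x T \<le> r + s + e"
      using S[of y] infdist_triangle[of x T y] by linarith
  qed
  have AB: "\<forall>a\<in>A. infdist a B \<le> hausdorff_dist A B" "\<forall>b\<in>B. infdist b A \<le> hausdorff_dist A B"
    using hausdorff_dist_le_iff[OF K(1,2)] by blast+
  have BC: "\<forall>b\<in>B. infdist b C \<le> hausdorff_dist B C" "\<forall>c\<in>C. infdist c B \<le> hausdorff_dist B C"
    using hausdorff_dist_le_iff[OF K(2,3)] by blast+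
  have "B \<noteq> {}" using K by (simp add: nonempty_compacts_def)
  then show "hausdorff_dist A C \<le> hausdorff_dist A B + hausdorff_dist B C"
    unfolding hausdorff_dist_le_iff[OF K(1,3)]
    using tri[of _ B _ C] tri[of _ B _ A] AB BC by (metis add.commute)
qed

definition hausdorff_borel :: "'a::metric_space set measure" where
  "hausdorff_borel =
    sigma nonempty_compacts
      {U. openin (Metric_space.mtopology nonempty_compacts hausdorff_dist) U}"

lemma space_hausdorff_borel [simp]: "space hausdorff_borel = (nonempty_compacts :: 'a::metric_space set set)"
  and sets_hausdorff_borel:
    "sets hausdorff_borel =
      sigma_sets (nonempty_compacts :: 'a set set)
        {U. openin (Metric_space.mtopology nonempty_compacts hausdorff_dist) U}"
proof -
  have "{U. openin (Metric_space.mtopology nonempty_compacts hausdorff_dist) U}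
      \<subseteq> Pow (nonempty_compacts :: 'a set set)"
    by (auto simp: Metric_space.openin_mtopology[OF Metric_space_hausdorff])
  then show "space hausdorff_borel = (nonempty_compacts :: 'a set set)"
    and "sets hausdorff_borel =
      sigma_sets (nonempty_compacts :: 'a set set)
        {U. openin (Metric_space.mtopology nonempty_compacts hausdorff_dist) U}"
    by (simp_all add: hausdorff_borel_def)
qed

definition sorgenfrey :: "real topology" where
  "sorgenfrey = topology_generated_by {{a..<b} | a b. True}"

lemma openin_sorgenfrey_iff:
  "openin sorgenfrey U \<longleftrightarrow> (\<forall>t\<in>U. \<exists>\<delta>>0. {t..<t+\<delta>} \<subseteq> U)"
proof
  assume "openin sorgenfrey U"
  then have "generate_topology_on {{a..<b} | a b :: real. True} U"
    by (simp add: sorgenfrey_def openin_topology_generated_by_iff)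
  then show "\<forall>t\<in>U. \<exists>\<delta>>0. {t..<t+\<delta>} \<subseteq> U"
  proof induction
    case (Int V W)
    show ?case
    proof
      fix t assume "t \<in> V \<inter> W"
      then obtain c d where "c > 0" "d > 0" "{t..<t+c} \<subseteq> V" "{t..<t+d} \<subseteq> W"
        using Int.IH by blast
      then show "\<exists>\<delta>>0. {t..<t+\<delta>} \<subseteq> V \<inter> W"
        by (intro exI[of _ "min c d"]) (auto simp: subset_iff)
    qed
  next
    case (UN K)
    then show ?case by (meson Union_iff Union_upper order_trans)
  next
    case (Basis S)
    then obtain a b where S: "S = {a..<b}" by auto
    show ?case
    proof
      fix t assume "t \<in> S"
      then show "\<exists>\<delta>>0. {t..<t+\<delta>} \<subseteq> S"
        by (intro exI[of _ "b - t"]) (auto simp: S)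
    qed
  qed simp
next
  assume *: "\<forall>t\<in>U. \<exists>\<delta>>0. {t..<t+\<delta>} \<subseteq> U"
  show "openin sorgenfrey U"
  proof (subst openin_subopen, intro ballI)
    fix t assume "t \<in> U"
    then obtain d where "d > 0" "{t..<t+d} \<subseteq> U" using * by blast
    moreover have "openin sorgenfrey {t..<t+d}"
      unfolding sorgenfrey_def by (rule topology_generated_by_Basis) blast
    ultimately show "\<exists>T. openin sorgenfrey T \<and> t \<in> T \<and> T \<subseteq> U"
      by (intro exI[of _ "{t..<t+d}"]) auto
  qed
qed

text \<open>
  Nonemptiness is stated explicitly because \<open>Inf {}\<close> is an unspecified real, not \<open>\<infinity>\<close>.
\<close>

definition scale_sets :: "real set set" where
  "scale_sets = {D. D \<subseteq> {0<..} \<and> D \<noteq> {} \<and> Inf D = 0 \<and> openin sorgenfrey D}"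

text \<open>
  The library's \<open>diameter\<close> is an unspecified real on unbounded sets, whose true diameter
  \<open>\<infinity>\<close> does not lie in \<open>D\<close>; hence the boundedness condition. As \<open>D\<close> contains only positive
  reals, \<open>powr\<close> agrees with the usual power for every \<open>s \<ge> 0\<close>. The infimum over the empty set
  of covers is \<open>\<infinity>\<close>.
\<close>

definition restricted_content :: "real set \<Rightarrow> real \<Rightarrow> 'a::metric_space set \<Rightarrow> ennreal" where
  "restricted_content D s E =
    (INF C \<in> {C :: nat \<Rightarrow> 'a set. E \<subseteq> (\<Union>i. C i) \<and> (\<forall>i. bounded (C i) \<and> diameter (C i) \<in> D)}.
      \<Sum>i. ennreal (diameter (C i) powr s))"

definition restricted_dim :: "real set \<Rightarrow> 'a::metric_space set \<Rightarrow> ennreal" where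
  "restricted_dim D E = (INF s \<in> {s. 0 \<le> s \<and> restricted_content D s E = 0}. ennreal s)"

definition universal_dim :: "'a::metric_space set \<Rightarrow> ennreal" where
  "universal_dim E = (SUP D \<in> scale_sets. restricted_dim D E)"

end

theory Submission
  imports Defs
begin

text \<open>
  That the dimension is at most the dimension of the space follows by covering bounded sets with
  balls of one small diameter (\<open>universal_dim_le_DIM\<close>).

  It is not Borel because it detects membership in a set that is too complicated. To each \<open>x\<close> in
  the Baire space \<open>nat \<Rightarrow> nat\<close> belongs a family of sets of natural numbers, the admissible ones,
  cut out by one condition at each element of the set. Having an infinite admissible set is an
  analytic property of \<open>x\<close>, and \<open>x\<close> itself codes the conditions, so that by diagonalisation the
  set of all \<open>x\<close> without infinite admissible sets is not analytic
  (\<open>not_analytic_set_no_infinite_admissible\<close>). As Borel sets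
  are analytic (\<open>borel_imp_analytic_set\<close>), it is not Borel.

  Now let \<open>coded_compact x\<close> be the set of all points on a line whose digit sequence, in a suitable
  mixed expansion, has nonzero digits exactly on an admissible set. It is compact, because
  admissibility is a closed condition, and it depends continuously on \<open>x\<close>
  (\<open>coded_compact_measurable\<close>), because initial segments of admissible sets are admissible. If \<open>x\<close> has
  only finite admissible sets, then there are only countably many digit sequences, and countable sets
  have dimension 0 for every \<open>D\<close>, as their points can be covered one by one at scales that decrease
  as fast as one likes. If \<open>A\<close> is an infinite admissible set, then the digits in \<open>A\<close> vary freely
  among the nonzero values. For \<open>D\<close> consisting of the scales at which single digits in \<open>A\<close> become
  visible, a set with diameter in \<open>D\<close> fixes such a digit, and a mass distribution argument bounds the
  dimension from below by \<open>1/6\<close> (\<open>restricted_content_coded_compact_ge_1\<close>). So \<open>x\<close> has no infinite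
  admissible set if and only if \<open>universal_dim (coded_compact x) = 0\<close>.
\<close>

section \<open>Analytic sets\<close>

text \<open>
  An analytic set is usually a continuous image of a Polish space; over a Polish space this agrees
  with being the projection of a closed subset of the product with the Baire space
  \<open>nat \<Rightarrow> nat\<close>, the form in which countable unions and intersections are easy.
\<close>

definition analytic_set :: "'a::topological_space set \<Rightarrow> bool" where
  "analytic_set B \<longleftrightarrow> (\<exists>R :: ('a \<times> (nat \<Rightarrow> nat)) set. closed R \<and> B = fst ` R)"

lemma closed_imp_analytic_set:
  assumes "closed B"
  shows "analytic_set B"
proof -
  have "closed (B \<times> (UNIV :: (nat \<Rightarrow> nat) set))" "B = fst ` (B \<times> (UNIV :: (nat \<Rightarrow> nat) set))"
    using assms by (auto intro: closed_Times)
  then show ?thesis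
    unfolding analytic_set_def by blast
qed

text \<open>
  The first entry of the witness names the set of the union, and the remaining entries are a witness
  for membership in it.
\<close>

lemma analytic_set_UN:
  fixes B :: "nat \<Rightarrow> 'a::topological_space set"
  assumes "\<And>i. analytic_set (B i)"
  shows "analytic_set (\<Union>i. B i)"
proof -
  obtain R :: "nat \<Rightarrow> ('a \<times> (nat \<Rightarrow> nat)) set"
    where R: "\<And>i. closed (R i)" "\<And>i. B i = fst ` R i"
    using assms unfolding analytic_set_def by metis
  define f :: "'a \<times> (nat \<Rightarrow> nat) \<Rightarrow> 'a \<times> (nat \<Rightarrow> nat)" where "f = (\<lambda>p. (fst p, \<lambda>k. snd p (Suc k)))"
  define Q where "Q = (\<Inter>i. {p. snd p 0 \<noteq> i} \<union> f -` R i)"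
  have snd: "continuous_on UNIV (\<lambda>p :: 'a \<times> (nat \<Rightarrow> nat). snd p k)" for k
    by (rule continuous_on_product_then_coordinatewise[OF continuous_on_snd[OF continuous_on_id]])
  have "continuous_on UNIV f"
    unfolding f_def
    by (intro continuous_on_Pair continuous_on_fst continuous_on_id
        continuous_on_coordinatewise_then_product snd)
  then have f: "closed (f -` R i)" for i
    by (rule closed_vimage[OF R(1)])
  have "closed ((\<lambda>p :: 'a \<times> (nat \<Rightarrow> nat). snd p 0) -` (-{i}))" for i
    by (intro closed_vimage snd) (simp add: closed_def open_discrete)
  then have "closed {p :: 'a \<times> (nat \<Rightarrow> nat). snd p 0 \<noteq> i}" for i
    by (simp add: vimage_def)
  then have "closed Q"
    unfolding Q_def using f by (intro closed_INT ballI closed_Un) auto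
  moreover have "(\<Union>i. B i) = fst ` Q"
  proof (intro subset_antisym subsetI)
    fix x assume "x \<in> (\<Union>i. B i)"
    then obtain i z where "(x, z) \<in> R i"
      using R(2) by fastforce
    then have "(x, case_nat i z) \<in> Q"
      by (auto simp: Q_def f_def)
    then show "x \<in> fst ` Q"
      by force
  next
    fix x assume "x \<in> fst ` Q"
    then obtain z where "(x, z) \<in> Q"
      by auto
    then have "f (x, z) \<in> R (z 0)"
      by (auto simp: Q_def)
    then show "x \<in> (\<Union>i. B i)"
      using R(2)[of "z 0"] by (force simp: f_def)
  qed
  ultimately show ?thesis
    unfolding analytic_set_def by blast
qed

text \<open>
  One sequence, cut into countably many rows by the pairing function, carries witnesses for all sets
  of the intersection at once.
\<close>

lemma analytic_set_INT:
  fixes B :: "nat \<Rightarrow> 'a::topological_space set"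
  assumes "\<And>i. analytic_set (B i)"
  shows "analytic_set (\<Inter>i. B i)"
proof -
  obtain R :: "nat \<Rightarrow> ('a \<times> (nat \<Rightarrow> nat)) set"
    where R: "\<And>i. closed (R i)" "\<And>i. B i = fst ` R i"
    using assms unfolding analytic_set_def by metis
  define f :: "nat \<Rightarrow> 'a \<times> (nat \<Rightarrow> nat) \<Rightarrow> 'a \<times> (nat \<Rightarrow> nat)"
    where "f = (\<lambda>i p. (fst p, \<lambda>k. snd p (prod_encode (i, k))))"
  define Q where "Q = (\<Inter>i. f i -` R i)"
  have "continuous_on UNIV (f i)" for i
    unfolding f_def
    by (intro continuous_on_Pair continuous_on_fst continuous_on_id continuous_on_snd
        continuous_on_coordinatewise_then_product continuous_on_product_then_coordinatewise)
  then have "closed Q"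
    unfolding Q_def using R(1) by (intro closed_INT ballI closed_vimage) auto
  moreover have "(\<Inter>i. B i) = fst ` Q"
  proof (intro subset_antisym subsetI)
    fix x assume "x \<in> (\<Inter>i. B i)"
    then have "\<forall>i. \<exists>z. (x, z) \<in> R i"
      using R(2) by fastforce
    then obtain z where "\<And>i. (x, z i) \<in> R i"
      by metis
    then have "(x, \<lambda>k. case prod_decode k of (i, j) \<Rightarrow> z i j) \<in> Q"
      by (auto simp: Q_def f_def)
    then show "x \<in> fst ` Q"
      by force
  next
    fix x assume "x \<in> fst ` Q"
    then obtain z where "(x, z) \<in> Q"
      by auto
    then have "f i (x, z) \<in> R i" for i
      by (auto simp: Q_def)
    then show "x \<in> (\<Inter>i. B i)"
      using R(2) by (force simp: f_def)
  qed
  ultimately show ?thesis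
    unfolding analytic_set_def by blast
qed

lemma open_imp_analytic_set:
  fixes U :: "'a::topological_space set"
  assumes "metrizable_space (euclidean :: 'a topology)" "open U"
  shows "analytic_set U"
proof (cases "U = {}")
  case True
  then show ?thesis
    by (simp add: closed_imp_analytic_set)
next
  case False
  have "fsigma_in (euclidean :: 'a topology) U"
    by (rule open_imp_fsigma_in[OF assms(1)]) (use assms(2) in simp)
  then obtain \<F> where F: "countable \<F>" "\<And>C. C \<in> \<F> \<Longrightarrow> closed C" "\<Union>\<F> = U"
    unfolding fsigma_in_def union_of_def by (auto simp only: subset_iff mem_Collect_eq closed_closedin)
  then have "range (from_nat_into \<F>) = \<F>"
    using False by (intro range_from_nat_into) auto
  with F have "U = (\<Union>i. from_nat_into \<F> i)" "\<And>i. closed (from_nat_into \<F> i)"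
    by auto
  then show ?thesis
    using analytic_set_UN closed_imp_analytic_set by metis
qed

text \<open>
  Analytic sets need not be closed under complements, so the induction over the Borel sets has to
  carry the set together with its complement.
\<close>

lemma borel_imp_analytic_set:
  fixes B :: "'a::topological_space set"
  assumes metrizable: "metrizable_space (euclidean :: 'a topology)" and "B \<in> sets borel"
  shows "analytic_set B"
proof -
  have "B \<in> sigma_sets UNIV {S. open S}"
    using \<open>B \<in> sets borel\<close> by (simp add: borel_def)
  then have "analytic_set B \<and> analytic_set (- B)"
  proof induction
    case (Basic U)
    then show ?case
      by (auto intro: open_imp_analytic_set[OF metrizable] closed_imp_analytic_set)
  next
    case Empty
    then show ?case
      by (simp add: closed_imp_analytic_set)
  next
    case (Compl B)
    then show ?case
      by (simp add: Compl_eq_Diff_UNIV[symmetric])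
  next
    case (Union B)
    then show ?case
      by (auto simp: Compl_UN intro!: analytic_set_UN analytic_set_INT)
  qed
  then show ?thesis ..
qed

section \<open>An analytic set that is not Borel\<close>

lemma open_fun_nat_imp_cylinder:
  fixes U :: "(nat \<Rightarrow> 'b::topological_space) set"
  assumes "open U" "x \<in> U"
  shows "\<exists>n. \<forall>y. (\<forall>j<n. y j = x j) \<longrightarrow> y \<in> U"
proof -
  obtain V where V: "finite {i. V i \<noteq> UNIV}" "x \<in> Pi\<^sub>E UNIV V" "Pi\<^sub>E UNIV V \<subseteq> U"
    using assms unfolding open_fun_def openin_product_topology_alt by auto
  obtain n where n: "\<And>i. V i \<noteq> UNIV \<Longrightarrow> i < n"
    using V(1) finite_nat_set_iff_bounded by auto
  have "y \<in> U" if "\<forall>j<n. y j = x j" for y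
  proof -
    have "y i \<in> V i" for i
      using V(2) n[of i] that by (cases "V i = UNIV") (auto simp: PiE_iff)
    then show ?thesis
      using V(3) by (auto simp: PiE_iff)
  qed
  then show ?thesis
    by blast
qed

lemma open_fun_nat_iff:
  fixes U :: "(nat \<Rightarrow> 'b::discrete_topology) set"
  shows "open U \<longleftrightarrow> (\<forall>x\<in>U. \<exists>n. \<forall>y. (\<forall>j<n. y j = x j) \<longrightarrow> y \<in> U)"
proof
  assume U: "\<forall>x\<in>U. \<exists>n. \<forall>y. (\<forall>j<n. y j = x j) \<longrightarrow> y \<in> U"
  show "open U"
  proof (subst open_subopen, intro ballI)
    fix x assume "x \<in> U"
    then obtain n where n: "\<forall>y. (\<forall>j<n. y j = x j) \<longrightarrow> y \<in> U"
      using U by blast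
    have "open {y. \<forall>j\<in>{..<n}. y j \<in> {x j}}"
      by (rule product_topology_basis') (auto intro: open_discrete)
    then show "\<exists>T. open T \<and> x \<in> T \<and> T \<subseteq> U"
      using n by (intro exI[of _ "{y. \<forall>j\<in>{..<n}. y j \<in> {x j}}"]) auto
  qed
qed (simp add: open_fun_nat_imp_cylinder)

text \<open>
  Membership in a closed set can be tested on finite initial segments; this is what makes closed
  sets codable by single sequences below.
\<close>

lemma closed_pair_prefix_limit:
  fixes R :: "((nat \<Rightarrow> 'b::topological_space) \<times> (nat \<Rightarrow> 'c::topological_space)) set"
  assumes "closed R"
    and approx: "\<And>n. \<exists>(y, w)\<in>R. \<forall>j<n. y j = x j \<and> w j = z j"
  shows "(x, z) \<in> R"
proof (rule ccontr)
  assume "(x, z) \<notin> R"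
  then obtain U V where UV: "open U" "open V" "x \<in> U" "z \<in> V" "U \<times> V \<subseteq> - R"
    using \<open>closed R\<close> unfolding closed_def open_prod_def by (metis ComplI mem_Sigma_iff)
  obtain m n where m: "\<forall>y. (\<forall>j<m. y j = x j) \<longrightarrow> y \<in> U"
      and n: "\<forall>w. (\<forall>j<n. w j = z j) \<longrightarrow> w \<in> V"
    using UV open_fun_nat_imp_cylinder by metis
  obtain y w where yw: "(y, w) \<in> R" "\<forall>j<max m n. y j = x j \<and> w j = z j"
    using approx[of "max m n"] by blast
  then have "y \<in> U" "w \<in> V"
    using m n by auto
  then show False
    using UV(5) yw(1) by blast
qed

lemma metrizable_space_fun_nat:
  "metrizable_space (euclidean :: (nat \<Rightarrow> 'b::discrete_topology) topology)"
proof -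
  have "(euclidean :: 'b topology) = discrete_topology UNIV"
    by (auto simp: topology_eq open_discrete)
  then have "metrizable_space (product_topology (\<lambda>_. euclidean :: 'b topology) (UNIV :: nat set))"
    by (simp add: metrizable_space_product_topology metrizable_space_discrete_topology)
  then show ?thesis
    by (simp add: euclidean_product_topology)
qed

definition prefix_code :: "(nat \<Rightarrow> nat) \<Rightarrow> nat \<Rightarrow> nat set \<Rightarrow> nat" where
  "prefix_code x i A = to_nat (map x [0..<i], set_encode (A \<inter> {..i}))"

lemma prefix_code_eq_iff:
  "prefix_code x i A = prefix_code y j B \<longleftrightarrow>
    i = j \<and> (\<forall>k<i. x k = y k) \<and> A \<inter> {..i} = B \<inter> {..i}"
proof -
  have "map x [0..<i] = map y [0..<j] \<longleftrightarrow> i = j \<and> (\<forall>k<i. x k = y k)"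
    by (auto simp: list_eq_iff_nth_eq)
  then show ?thesis
    by (auto simp: prefix_code_def set_encode_eq)
qed

text \<open>
  The sequence \<open>x\<close> is read as a set of codes, namely those on which it vanishes, and each element of
  \<open>A\<close> imposes one condition on an initial segment of the pair \<open>(x, A)\<close>. That \<open>x\<close> occurs both as
  the set of permitted codes and inside the codes makes the diagonal argument below possible. As the
  conditions sit at the elements of \<open>A\<close> only, initial segments of admissible sets are admissible, and
  so is the empty set.
\<close>

definition admissible :: "(nat \<Rightarrow> nat) \<Rightarrow> nat set \<Rightarrow> bool" where
  "admissible x A \<longleftrightarrow> (\<forall>i\<in>A. x (prefix_code x i A) = 0)"

text \<open>
  Taking ranges of these sequences identifies the Baire space with the infinite sets of natural
  numbers: the entries of \<open>z\<close> are the gaps between consecutive elements.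
\<close>

definition partial_sums :: "(nat \<Rightarrow> nat) \<Rightarrow> nat \<Rightarrow> nat" where
  "partial_sums z k = k + (\<Sum>j\<le>k. z j)"

lemma strict_mono_partial_sums: "strict_mono (partial_sums z)"
  by (rule strict_monoI_Suc) (simp add: partial_sums_def)

lemma infinite_range_partial_sums: "infinite (range (partial_sums z))"
  by (metis finite_imageD infinite_UNIV_nat strict_mono_imp_inj_on strict_mono_partial_sums)

lemma infinite_nat_set_eq_range_partial_sums:
  assumes "infinite A"
  obtains z where "A = range (partial_sums z)"
proof -
  define a where "a = enumerate A"
  define z where "z k = (case k of 0 \<Rightarrow> a 0 | Suc l \<Rightarrow> a (Suc l) - Suc (a l))" for k
  have "partial_sums z k = a k" for k
  proof (induction k)
    case 0
    then show ?case
      by (simp add: partial_sums_def z_def)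
  next
    case (Suc k)
    have "a k < a (Suc k)"
      using assms by (simp add: a_def enumerate_step)
    with Suc show ?case
      by (simp add: partial_sums_def z_def)
  qed
  then have "range (partial_sums z) = range a"
    by auto
  also have "\<dots> = A"
    using assms by (simp add: a_def range_enumerate)
  finally show ?thesis
    using that by blast
qed

text \<open>
  The part of the range up to \<open>a k\<close> determines the first \<open>k + 1\<close> terms, because they are enumerated in
  increasing order.
\<close>

lemma strict_mono_eq_on_prefix:
  fixes a b :: "nat \<Rightarrow> nat"
  assumes a: "strict_mono a" and b: "strict_mono b"
    and eq: "range a \<inter> {..a k} = range b \<inter> {..a k}" and "j \<le> k"
  shows "a j = b j"
  using \<open>j \<le> k\<close>
proof (induction j rule: less_induct)
  case (less j)
  then have jk: "a j \<le> a k"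
    using strict_mono_less_eq[OF a] by simp
  then have "a j \<in> range b"
    using eq by blast
  then obtain l where l: "a j = b l"
    by blast
  have "l \<ge> j"
  proof (rule ccontr)
    assume "\<not> l \<ge> j"
    then have "a l = b l"
      using less by simp
    with l \<open>\<not> l \<ge> j\<close> show False
      using strict_mono_eq[OF a] by (metis order_refl)
  qed
  moreover have "\<not> l > j"
  proof
    assume "l > j"
    then have "b j < a j"
      using strict_mono_less[OF b] l by simp
    then have "b j \<in> range a"
      using eq jk by (metis IntD1 IntI atMost_iff less_imp_le order_trans rangeI)
    then obtain i where i: "b j = a i"
      by blast
    then have "i < j"
      using \<open>b j < a j\<close> strict_mono_less[OF a] by simp
    then have "b j = b i"
      using i less by simp
    with \<open>i < j\<close> show False
      using strict_mono_eq[OF b] by simp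
  qed
  ultimately show ?case
    using l by simp
qed

lemma partial_sums_eq_imp_eq:
  assumes "\<forall>j\<le>k. partial_sums z j = partial_sums w j" "j \<le> k"
  shows "z j = w j"
proof (cases j)
  case 0
  then show ?thesis
    using assms(1)[rule_format, of 0] by (simp add: partial_sums_def)
next
  case (Suc l)
  then show ?thesis
    using assms(1)[rule_format, of l] assms(1)[rule_format, of "Suc l"] assms(2)
    by (simp add: partial_sums_def)
qed

text \<open>
  Cantor's diagonal argument. Suppose that the set is the projection of a closed set \<open>R\<close>. Let \<open>c\<close>
  vanish exactly on the codes of initial segments of pairs in \<open>R\<close>, with second components read as
  infinite sets. As \<open>R\<close> is closed, an infinite set is admissible for \<open>c\<close> if and only if it is a
  witness that \<open>c\<close> lies in the projection, that is, a witness that \<open>c\<close> has no infinite admissible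
  set.
\<close>

lemma not_analytic_set_no_infinite_admissible:
  "\<not> analytic_set {x. \<not> (\<exists>A. infinite A \<and> admissible x A)}"
proof
  assume "analytic_set {x. \<not> (\<exists>A. infinite A \<and> admissible x A)}"
  then obtain R :: "((nat \<Rightarrow> nat) \<times> (nat \<Rightarrow> nat)) set"
    where R: "closed R" and proj: "{x. \<not> (\<exists>A. infinite A \<and> admissible x A)} = fst ` R"
    unfolding analytic_set_def by blast
  define P where "P = {prefix_code x i (range (partial_sums z)) | x i z. (x, z) \<in> R}"
  define c :: "nat \<Rightarrow> nat" where "c n = (if n \<in> P then 0 else 1)" for n
  have "c \<in> fst ` R \<longleftrightarrow> (\<exists>A. infinite A \<and> admissible c A)"
  proof
    assume "c \<in> fst ` R"
    then obtain z where "(c, z) \<in> R"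
      by auto
    then have "admissible c (range (partial_sums z))"
      by (auto simp: admissible_def c_def P_def)
    then show "\<exists>A. infinite A \<and> admissible c A"
      using infinite_range_partial_sums by blast
  next
    assume "\<exists>A. infinite A \<and> admissible c A"
    then obtain z where adm: "admissible c (range (partial_sums z))"
      by (metis infinite_nat_set_eq_range_partial_sums)
    have "\<exists>(y, w)\<in>R. \<forall>j<n. y j = c j \<and> w j = z j" for n
    proof -
      \<comment> \<open>The condition at the element number \<open>n\<close> of the admissible set yields a pair in \<open>R\<close> whose
        components agree with \<open>c\<close> and \<open>z\<close> on at least \<open>n\<close> entries.\<close>
      define i where "i = partial_sums z n"
      have "c (prefix_code c i (range (partial_sums z))) = 0"
        using adm by (simp add: admissible_def i_def)
      then have "prefix_code c i (range (partial_sums z)) \<in> P"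
        by (auto simp: c_def split: if_splits)
      then obtain y w where yw: "(y, w) \<in> R" "\<forall>k<i. c k = y k"
        "range (partial_sums z) \<inter> {..i} = range (partial_sums w) \<inter> {..i}"
        unfolding P_def by (auto simp: prefix_code_eq_iff)
      have "\<forall>j\<le>n. partial_sums z j = partial_sums w j"
        using strict_mono_eq_on_prefix[OF strict_mono_partial_sums strict_mono_partial_sums
            yw(3)[unfolded i_def]] by blast
      then have "\<forall>j\<le>n. z j = w j"
        using partial_sums_eq_imp_eq by blast
      moreover have "n \<le> i"
        by (simp add: i_def partial_sums_def)
      ultimately show ?thesis
        using yw(1,2) by (intro bexI[of _ "(y, w)"]) auto
    qed
    then have "(c, z) \<in> R"
      using closed_pair_prefix_limit[OF R] by blast
    then show "c \<in> fst ` R"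
      by force
  qed
  then show False
    using proj by blast
qed

section \<open>Upper bounds for the restricted dimension\<close>

lemma scale_set_unbounded_below:
  assumes "D \<in> scale_sets" "0 < \<epsilon>"
  obtains d where "d \<in> D" "0 < d" "d < \<epsilon>"
proof -
  have "D \<noteq> {}" "Inf D < \<epsilon>" "D \<subseteq> {0<..}"
    using assms by (auto simp: scale_sets_def)
  then obtain d where "d \<in> D" "d < \<epsilon>"
    using cInf_lessD by blast
  with \<open>D \<subseteq> {0<..}\<close> that show ?thesis
    by auto
qed

text \<open>
  With a positive exponent, infinitely many scales in \<open>D\<close> can be spent at arbitrarily small total
  cost. Every cover in the definition of the content is an infinite sequence of sets with diameters
  in \<open>D\<close>, so even finite covers need such a sequence as padding.
\<close>

lemma scale_set_summable_sequence:
  assumes D: "D \<in> scale_sets" and "0 < s" "0 < \<epsilon>"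
  obtains d where "\<And>i. d i \<in> D" "(\<Sum>i. ennreal (d i powr s)) \<le> ennreal \<epsilon>"
proof -
  have "\<exists>d\<in>D. d powr s \<le> \<epsilon> * (1/2) ^ Suc i" for i
  proof -
    have pos: "0 < \<epsilon> * (1/2) ^ Suc i"
      using \<open>0 < \<epsilon>\<close> by simp
    then obtain d where d: "d \<in> D" "0 < d" "d < (\<epsilon> * (1/2) ^ Suc i) powr (1 / s)"
      using scale_set_unbounded_below[OF D] by (metis powr_gt_zero less_irrefl)
    have "d powr s \<le> ((\<epsilon> * (1/2) ^ Suc i) powr (1 / s)) powr s"
      using d \<open>0 < s\<close> by (intro powr_mono2) auto
    also have "\<dots> = \<epsilon> * (1/2) ^ Suc i"
      using pos \<open>0 < s\<close> by (simp only: powr_powr) simp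
    finally show ?thesis
      using d(1) by blast
  qed
  then obtain d where d: "\<And>i. d i \<in> D" "\<And>i. d i powr s \<le> \<epsilon> * (1/2) ^ Suc i"
    by metis
  have "(\<lambda>i. \<epsilon> * (1/2) ^ Suc i) sums \<epsilon>"
    using sums_mult[OF power_half_series, of \<epsilon>] by simp
  then have "(\<Sum>i. ennreal (\<epsilon> * (1/2) ^ Suc i)) = ennreal \<epsilon>"
    using \<open>0 < \<epsilon>\<close> by (intro suminf_ennreal_eq) auto
  moreover have "(\<Sum>i. ennreal (d i powr s)) \<le> (\<Sum>i. ennreal (\<epsilon> * (1/2) ^ Suc i))"
    by (intro suminf_le ennreal_leI d(2)) auto
  ultimately show ?thesis
    using that d(1) by metis
qed

text \<open>
  In a Euclidean space the closed ball of radius \<open>d / 2\<close> has diameter exactly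
  \<open>d\<close>, so balls provide sets of every diameter in \<open>D\<close>.
\<close>

lemma restricted_content_eq_0I:
  fixes E :: "'a::euclidean_space set"
  assumes D: "D \<subseteq> {0<..}"
    and cover: "\<And>\<epsilon>. 0 < \<epsilon> \<Longrightarrow> \<exists>(c :: nat \<Rightarrow> 'a) d. (\<forall>i. d i \<in> D) \<and>
      E \<subseteq> (\<Union>i. cball (c i) (d i / 2)) \<and> (\<Sum>i. ennreal (d i powr s)) \<le> ennreal \<epsilon>"
  shows "restricted_content D s E = 0"
proof -
  have "restricted_content D s E \<le> 0 + ennreal \<epsilon>" if \<epsilon>: "0 < \<epsilon>" for \<epsilon>
  proof -
    obtain c :: "nat \<Rightarrow> 'a" and d where cd: "\<forall>i. d i \<in> D"
        "E \<subseteq> (\<Union>i. cball (c i) (d i / 2))" "(\<Sum>i. ennreal (d i powr s)) \<le> ennreal \<epsilon>"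
      using cover[OF \<epsilon>] by blast
    have diam: "diameter (cball (c i) (d i / 2)) = d i" for i
      using cd(1)[rule_format, of i] D by (auto simp: less_imp_le subset_iff)
    have "restricted_content D s E \<le> (\<Sum>i. ennreal (diameter (cball (c i) (d i / 2)) powr s))"
      unfolding restricted_content_def
      by (rule INF_lower) (use cd diam in auto)
    then show ?thesis
      unfolding diam using cd(3) by simp
  qed
  then have "restricted_content D s E \<le> 0"
    by (rule ennreal_le_epsilon)
  then show ?thesis
    by simp
qed

lemma restricted_dim_leI:
  assumes "0 \<le> t" and zero: "\<And>s. t < s \<Longrightarrow> restricted_content D s E = 0"
  shows "restricted_dim D E \<le> ennreal t"
proof (rule ennreal_le_epsilon)
  fix e :: real assume "0 < e"
  have "restricted_dim D E \<le> ennreal (t + e)"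
    unfolding restricted_dim_def
    by (rule INF_lower) (use assms \<open>0 < e\<close> in auto)
  then show "restricted_dim D E \<le> ennreal t + ennreal e"
    using assms \<open>0 < e\<close> by (simp add: ennreal_plus)
qed

lemma universal_dim_countable:
  fixes E :: "'a::euclidean_space set"
  assumes "countable E"
  shows "universal_dim E = 0"
proof -
  have "restricted_dim D E \<le> ennreal 0" if D: "D \<in> scale_sets" for D
  proof (rule restricted_dim_leI[OF order_refl], rule restricted_content_eq_0I)
    show sub: "D \<subseteq> {0<..}"
      using D by (simp add: scale_sets_def)
    fix s \<epsilon> :: real assume "0 < s" "0 < \<epsilon>"
    then obtain d where d: "\<And>i. d i \<in> D" "(\<Sum>i. ennreal (d i powr s)) \<le> ennreal \<epsilon>"
      using scale_set_summable_sequence[OF D] by metis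
    have "E \<subseteq> (\<Union>i. cball (from_nat_into E i) (d i / 2))"
    proof
      fix x assume "x \<in> E"
      then obtain i where "from_nat_into E i = x"
        using assms from_nat_into_surj by metis
      moreover have "0 \<le> d i"
        using d(1)[of i] sub by (auto simp: less_imp_le)
      ultimately show "x \<in> (\<Union>i. cball (from_nat_into E i) (d i / 2))"
        by (intro UN_I[of i]) auto
    qed
    with d show "\<exists>(c :: nat \<Rightarrow> 'a) d. (\<forall>i. d i \<in> D) \<and>
      E \<subseteq> (\<Union>i. cball (c i) (d i / 2)) \<and> (\<Sum>i. ennreal (d i powr s)) \<le> ennreal \<epsilon>"
      by blast
  qed
  then have "universal_dim E \<le> 0"
    unfolding universal_dim_def by (intro SUP_least) simp
  then show ?thesis
    by simp
qed

text \<open>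
  The centres form the grid with mesh \<open>d / (2 * DIM('a))\<close>: rounding down each coordinate changes a
  point by at most \<open>d / 2\<close> in the sum norm.
\<close>

lemma bounded_covering_number:
  fixes E :: "'a::euclidean_space set"
  assumes "bounded E"
  obtains C :: real where "0 < C"
    "\<And>d. \<lbrakk>0 < d; d \<le> 1\<rbrakk> \<Longrightarrow> \<exists>F. finite F \<and> card F \<le> C / d ^ DIM('a) \<and> E \<subseteq> (\<Union>x\<in>F. cball x (d / 2))"
proof -
  let ?n = "DIM('a)"
  obtain R where R: "0 < R" "\<And>x. x \<in> E \<Longrightarrow> norm x \<le> R"
    using assms by (auto simp: bounded_pos)
  have n: "0 < real ?n"
    by simp
  define C where "C = (4 * ?n * R + 3) ^ ?n"
  have "\<exists>F. finite F \<and> card F \<le> C / d ^ ?n \<and> E \<subseteq> (\<Union>x\<in>F. cball x (d / 2))"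
    if d: "0 < d" "d \<le> 1" for d
  proof -
    define h where "h = d / (2 * ?n)"
    have h: "0 < h"
      using d n by (simp add: h_def)
    define M where "M = \<lceil>R / h\<rceil>"
    have M: "0 \<le> M"
      using R h by (simp add: M_def) (meson divide_pos_pos less_trans neg_less_0_iff_less zero_less_one)
    define g :: "('a \<Rightarrow> int) \<Rightarrow> 'a" where "g f = (\<Sum>b\<in>Basis. (h * of_int (f b)) *\<^sub>R b)" for f
    define P where "P = (Basis :: 'a set) \<rightarrow>\<^sub>E {- M..M}"
    have "finite P"
      unfolding P_def by (intro finite_PiE) auto
    have "real (card (g ` P)) \<le> real (card P)"
      using \<open>finite P\<close> by (simp add: card_image_le)
    also have "card P = nat (2 * M + 1) ^ ?n"
      by (simp add: P_def card_PiE algebra_simps)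
    also have "real (nat (2 * M + 1) ^ ?n) = (2 * of_int M + 1) ^ ?n"
      using M by simp
    also have "\<dots> \<le> ((4 * ?n * R + 3) / d) ^ ?n"
    proof (rule power_mono)
      have "of_int M \<le> R / h + 1"
        unfolding M_def by linarith
      then have "2 * real_of_int M + 1 \<le> 2 * (R / h) + 3"
        by simp
      also have "\<dots> = (4 * ?n * R + 3 * d) / d"
        using d n by (simp add: h_def field_simps)
      also have "\<dots> \<le> (4 * ?n * R + 3) / d"
        using d by (intro divide_right_mono) auto
      finally show "2 * real_of_int M + 1 \<le> (4 * ?n * R + 3) / d" .
    qed (use M in simp)
    finally have "real (card (g ` P)) \<le> C / d ^ ?n"
      by (simp add: C_def power_divide)
    moreover have "E \<subseteq> (\<Union>x\<in>g ` P. cball x (d / 2))"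
    proof
      fix x assume "x \<in> E"
      define f where "f = (\<lambda>b\<in>Basis. \<lfloor>x \<bullet> b / h\<rfloor>)"
      have "f \<in> P"
        unfolding P_def
      proof (rule PiE_I)
        fix b :: 'a assume b: "b \<in> Basis"
        have "\<bar>x \<bullet> b\<bar> \<le> R"
          using Basis_le_norm[OF b, of x] R(2)[OF \<open>x \<in> E\<close>] by linarith
        then have "\<bar>x \<bullet> b / h\<bar> \<le> R / h"
          using h by (simp add: abs_divide divide_right_mono)
        then have "- \<lceil>R / h\<rceil> \<le> \<lfloor>x \<bullet> b / h\<rfloor>" "\<lfloor>x \<bullet> b / h\<rfloor> \<le> \<lceil>R / h\<rceil>"
          by linarith+
        then show "f b \<in> {- M..M}"
          unfolding M_def f_def using b by simp
      qed (simp add: f_def)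
      have "norm (x - g f) \<le> (\<Sum>b\<in>Basis. \<bar>(x - g f) \<bullet> b\<bar>)"
        by (rule norm_le_l1)
      also have "\<dots> \<le> (\<Sum>b\<in>(Basis :: 'a set). h)"
      proof (rule sum_mono)
        fix b :: 'a assume b: "b \<in> Basis"
        have "g f \<bullet> b = h * of_int \<lfloor>x \<bullet> b / h\<rfloor>"
          using b by (simp add: g_def f_def inner_sum_left_Basis)
        then have "(x - g f) \<bullet> b = h * (x \<bullet> b / h - of_int \<lfloor>x \<bullet> b / h\<rfloor>)"
          using h by (simp add: inner_diff_left right_diff_distrib)
        moreover have "0 \<le> x \<bullet> b / h - of_int \<lfloor>x \<bullet> b / h\<rfloor>" "x \<bullet> b / h - of_int \<lfloor>x \<bullet> b / h\<rfloor> \<le> 1"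
          by linarith+
        ultimately show "\<bar>(x - g f) \<bullet> b\<bar> \<le> h"
          using h by (simp add: abs_mult mult_left_le)
      qed
      also have "\<dots> = d / 2"
        using n by (simp add: h_def)
      finally have "x \<in> cball (g f) (d / 2)"
        by (simp add: dist_norm norm_minus_commute)
      with \<open>f \<in> P\<close> show "x \<in> (\<Union>x\<in>g ` P. cball x (d / 2))"
        by blast
    qed
    ultimately show ?thesis
      using \<open>finite P\<close> by blast
  qed
  moreover have "0 < C"
    unfolding C_def using R by (intro zero_less_power add_nonneg_pos) auto
  ultimately show ?thesis
    using that by blast
qed

text \<open>
  Of the order of \<open>d\<close> to the power \<open>- DIM('a)\<close> balls of diameter \<open>d\<close> cover the set, and \<open>D\<close> contains
  arbitrarily small \<open>d\<close>; above the dimension the total cost tends to 0.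
\<close>

lemma universal_dim_le_DIM:
  fixes E :: "'a::euclidean_space set"
  assumes "bounded E"
  shows "universal_dim E \<le> of_nat DIM('a)"
proof -
  obtain C :: real where "0 < C" and C: "\<And>d. \<lbrakk>0 < d; d \<le> 1\<rbrakk> \<Longrightarrow>
      \<exists>F. finite F \<and> card F \<le> C / d ^ DIM('a) \<and> E \<subseteq> (\<Union>x\<in>F. cball x (d / 2))"
    using bounded_covering_number[OF assms] by blast
  have "restricted_dim D E \<le> ennreal DIM('a)" if D: "D \<in> scale_sets" for D
  proof (rule restricted_dim_leI, simp, rule restricted_content_eq_0I)
    show "D \<subseteq> {0<..}"
      using D by (simp add: scale_sets_def)
    fix s \<epsilon> :: real assume s: "DIM('a) < s" and "0 < \<epsilon>"
    define \<delta> where "\<delta> = (\<epsilon> / 2 / C) powr (1 / (s - DIM('a)))"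
    have "0 < \<delta>"
      using \<open>0 < C\<close> \<open>0 < \<epsilon>\<close> by (simp add: \<delta>_def)
    then obtain d where d: "d \<in> D" "0 < d" "d < min 1 \<delta>"
      using scale_set_unbounded_below[OF D, of "min 1 \<delta>"] by auto
    obtain F where F: "finite F" "card F \<le> C / d ^ DIM('a)" "E \<subseteq> (\<Union>x\<in>F. cball x (d / 2))"
      using C[of d] d by auto
    obtain f where f: "bij_betw f {..<card F} F"
      using ex_bij_betw_nat_finite[OF F(1)] by (auto simp: atLeast0LessThan)
    have "0 < s"
      using s by (metis of_nat_0_le_iff order_le_less_trans)
    then obtain d' where d': "\<And>i. d' i \<in> D" "(\<Sum>i. ennreal (d' i powr s)) \<le> ennreal (\<epsilon> / 2)"
      using scale_set_summable_sequence[OF D] \<open>0 < \<epsilon>\<close> by (metis half_gt_zero)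
    \<comment> \<open>Finitely many balls of the same diameter cover the set; the remaining ones are cheap padding.\<close>
    define r where "r i = (if i < card F then d else d' i)" for i
    have "E \<subseteq> (\<Union>i. cball (f i) (r i / 2))"
    proof
      fix x assume "x \<in> E"
      then obtain y where "y \<in> F" "x \<in> cball y (d / 2)"
        using F(3) by blast
      moreover obtain i where "i < card F" "y = f i"
        using \<open>y \<in> F\<close> f by (auto simp: bij_betw_def)
      ultimately have "x \<in> cball (f i) (r i / 2)"
        by (simp add: r_def)
      then show "x \<in> (\<Union>i. cball (f i) (r i / 2))"
        by blast
    qed
    moreover have "\<forall>i. r i \<in> D"
      using d d' by (simp add: r_def)
    moreover have "(\<Sum>i. ennreal (r i powr s)) \<le> ennreal \<epsilon>"
    proof -
      have "(\<Sum>i. ennreal (r i powr s)) \<le>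
          (\<Sum>i. (if i < card F then ennreal (d powr s) else 0) + ennreal (d' i powr s))"
        by (intro suminf_le) (auto simp: r_def)
      also have "\<dots> = (\<Sum>i. (if i < card F then ennreal (d powr s) else 0))
          + (\<Sum>i. ennreal (d' i powr s))"
        by (intro suminf_add[symmetric]) auto
      also have "(\<Sum>i. (if i < card F then ennreal (d powr s) else 0))
          = (\<Sum>i<card F. ennreal (d powr s))"
        by (subst suminf_finite[of "{..<card F}"]) auto
      also have "\<dots> = ennreal (card F * d powr s)"
        by (simp add: ennreal_mult ennreal_of_nat_eq_real_of_nat)
      also have "\<dots> + (\<Sum>i. ennreal (d' i powr s)) \<le> ennreal (\<epsilon> / 2) + ennreal (\<epsilon> / 2)"
      proof (intro add_mono ennreal_leI d'(2))
        have "card F * d powr s \<le> C / d ^ DIM('a) * d powr s"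
          using F(2) by (intro mult_right_mono) auto
        also have "\<dots> = C * d powr (s - DIM('a))"
          using d(2) by (simp add: powr_diff powr_realpow)
        also have "\<dots> \<le> C * \<delta> powr (s - DIM('a))"
          using d \<open>0 < C\<close> s by (intro mult_left_mono powr_mono2) auto
        also have "\<dots> = \<epsilon> / 2"
          using \<open>0 < C\<close> \<open>0 < \<epsilon>\<close> s by (simp add: \<delta>_def powr_powr)
        finally show "card F * d powr s \<le> \<epsilon> / 2" .
      qed
      also have "\<dots> = ennreal \<epsilon>"
        using \<open>0 < \<epsilon>\<close> by (simp flip: ennreal_plus)
      finally show ?thesis .
    qed
    ultimately show "\<exists>(c :: nat \<Rightarrow> 'a) d. (\<forall>i. d i \<in> D) \<and>
      E \<subseteq> (\<Union>i. cball (c i) (d i / 2)) \<and> (\<Sum>i. ennreal (d i powr s)) \<le> ennreal \<epsilon>"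
      by blast
  qed
  then show ?thesis
    unfolding universal_dim_def by (auto intro!: SUP_least simp: ennreal_of_nat_eq_real_of_nat)
qed

section \<open>Coding admissible sets into compact sets\<close>

text \<open>
  Points of the line are coded by mixed expansions whose \<open>i\<close>-th digit ranges over
  \<open>{0..width i}\<close> and has weight \<open>1 / width i ^ 4\<close>. Two features of this choice matter. The largest
  possible sum of the terms after the \<open>i\<close>-th is at most \<open>2 / width (Suc i) ^ 3 = 2 / width i ^ 6\<close>,
  which is at most half a unit of the \<open>i\<close>-th digit, so the digits can be read off from the point.
  And the number of values of the single digit \<open>i\<close> is a fixed power of the scale
  \<open>1 / width i ^ 4\<close>, so a free digit at \<open>i\<close> is felt at that scale even if all earlier digits are
  fixed. Doubly exponential growth of the widths reconciles the two.
\<close>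

definition width :: "nat \<Rightarrow> nat" where
  "width i = 2 ^ 2 ^ i"

lemma width_ge_2: "2 \<le> width i"
  unfolding width_def by (rule self_le_power) auto

lemma width_pos: "0 < width i"
  using width_ge_2[of i] by linarith

lemma width_Suc: "width (Suc i) = width i ^ 2"
  by (simp add: width_def power_mult[symmetric] mult.commute)

lemma width_growth: "width i * 2 ^ l \<le> width (i + l)"
proof (induction l)
  case (Suc l)
  have "width i * 2 ^ Suc l = 2 * (width i * 2 ^ l)"
    by simp
  also have "\<dots> \<le> width (i + l) * width (i + l)"
    using Suc width_ge_2[of "i + l"] by (intro mult_mono) auto
  finally show ?case
    by (simp add: width_Suc power2_eq_square)
qed simp

lemma width_mono: "i \<le> j \<Longrightarrow> width i \<le> width j"
  by (simp add: width_def)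

lemma inverse_width_cube_le: "1 / real (width (j + i)) ^ 3 \<le> 1 / real (width i) ^ 3 * (1/2) ^ j"
proof -
  have "width i ^ 3 * 2 ^ j \<le> width i ^ 3 * (2 ^ j) ^ 3"
    by (intro mult_left_mono self_le_power) auto
  also have "\<dots> \<le> width (j + i) ^ 3"
    using width_growth[of i j] by (simp add: power_mult_distrib[symmetric] power_mono add.commute)
  finally have "real (width i ^ 3 * 2 ^ j) \<le> real (width (j + i) ^ 3)"
    by (rule of_nat_mono)
  then have "real (width i) ^ 3 * 2 ^ j \<le> real (width (j + i)) ^ 3"
    by simp
  then have "1 / real (width (j + i)) ^ 3 \<le> 1 / (real (width i) ^ 3 * 2 ^ j)"
    using width_pos by (intro divide_left_mono) auto
  then show ?thesis
    by (simp add: power_divide)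
qed

lemma width_cube_vanishes:
  assumes "0 < \<epsilon>"
  obtains n where "2 / real (width n) ^ 3 < \<epsilon>"
proof -
  obtain n where n: "(1/2 :: real) ^ n < \<epsilon>"
    using real_arch_pow_inv[OF assms, of "1/2"] by auto
  have "1 / real (width n) ^ 3 \<le> 1 / 8 * (1/2) ^ n"
    using inverse_width_cube_le[of n 0] by (simp add: width_def)
  moreover have "0 < (1/2 :: real) ^ n"
    by simp
  ultimately have "2 / real (width n) ^ 3 < \<epsilon>"
    using n by linarith
  then show ?thesis
    by (rule that)
qed

definition digit_seqs :: "(nat \<Rightarrow> nat) set" where
  "digit_seqs = {v. \<forall>i. v i \<le> width i}"

definition expansion :: "(nat \<Rightarrow> nat) \<Rightarrow> real" where
  "expansion v = (\<Sum>i. real (v i) / real (width i) ^ 4)"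

lemma digit_term_le:
  assumes "v \<in> digit_seqs"
  shows "real (v i) / real (width i) ^ 4 \<le> 1 / real (width i) ^ 3"
proof -
  have "real (v i) / real (width i) ^ 4 \<le> real (width i) / real (width i) ^ 4"
    using assms by (intro divide_right_mono) (auto simp: digit_seqs_def)
  also have "\<dots> = 1 / real (width i) ^ 3"
    using width_pos[of i] by (simp add: field_simps eval_nat_numeral)
  finally show ?thesis .
qed

lemma summable_geometric_bound: "summable (\<lambda>j. 1 / real (width i) ^ 3 * (1/2) ^ j)"
  by (intro summable_mult summable_geometric) simp

lemma summable_expansion:
  assumes "v \<in> digit_seqs"
  shows "summable (\<lambda>i. real (v i) / real (width i) ^ 4)"
proof (rule summable_comparison_test'[OF summable_geometric_bound[of 0]])
  fix i
  show "norm (real (v i) / real (width i) ^ 4) \<le> 1 / real (width 0) ^ 3 * (1/2) ^ i"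
    using digit_term_le[OF assms, of i] inverse_width_cube_le[of i 0] by simp
qed

lemma expansion_diff_le:
  assumes v: "v \<in> digit_seqs" and w: "w \<in> digit_seqs" and eq: "\<forall>j<n. v j = w j"
  shows "\<bar>expansion v - expansion w\<bar> \<le> 2 / real (width n) ^ 3"
proof -
  define d where "d j = real (v j) / real (width j) ^ 4 - real (w j) / real (width j) ^ 4" for j
  have d: "summable d"
    unfolding d_def using v w by (intro summable_diff summable_expansion)
  have "expansion v - expansion w = suminf d"
    unfolding expansion_def d_def using v w by (intro suminf_diff summable_expansion)
  also have "\<dots> = (\<Sum>j. d (j + n)) + (\<Sum>j<n. d j)"
    using d by (rule suminf_split_initial_segment)
  also have "(\<Sum>j<n. d j) = 0"
    using eq by (simp add: d_def)
  finally have "expansion v - expansion w = (\<Sum>j. d (j + n))"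
    by simp
  moreover have "norm (\<Sum>j. d (j + n)) \<le> (\<Sum>j. 1 / real (width n) ^ 3 * (1/2) ^ j)"
  proof (rule norm_suminf_le[OF _ summable_geometric_bound])
    fix j
    have "0 \<le> real (v (j + n)) / real (width (j + n)) ^ 4" "0 \<le> real (w (j + n)) / real (width (j + n)) ^ 4"
      by simp_all
    then show "norm (d (j + n)) \<le> 1 / real (width n) ^ 3 * (1/2) ^ j"
      using digit_term_le[OF v, of "j + n"] digit_term_le[OF w, of "j + n"]
        inverse_width_cube_le[of j n]
      unfolding d_def real_norm_def by linarith
  qed
  moreover have "(\<Sum>j. 1 / real (width n) ^ 3 * (1/2) ^ j) = 2 / real (width n) ^ 3"
    by (subst suminf_mult) (simp_all add: suminf_geometric)
  ultimately show ?thesis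
    by simp
qed

lemma expansion_fun_upd:
  assumes v: "v \<in> digit_seqs" and a: "a \<le> width i"
  shows "expansion (v(i := a)) = expansion v + (real a - real (v i)) / real (width i) ^ 4"
proof -
  have v': "v(i := a) \<in> digit_seqs"
    using v a by (simp add: digit_seqs_def)
  have "expansion (v(i := a)) - expansion v =
      (\<Sum>j. real ((v(i := a)) j) / real (width j) ^ 4 - real (v j) / real (width j) ^ 4)"
    unfolding expansion_def using v v' by (intro suminf_diff summable_expansion)
  also have "\<dots> = (\<Sum>j\<in>{i}. real ((v(i := a)) j) / real (width j) ^ 4 - real (v j) / real (width j) ^ 4)"
    by (rule suminf_finite) auto
  also have "\<dots> = (real a - real (v i)) / real (width i) ^ 4"
    by (simp add: diff_divide_distrib)
  finally show ?thesis
    by simp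
qed

text \<open>
  Replacing the digit \<open>i\<close> of \<open>v\<close> by that of \<open>w\<close> moves the point by at least one unit of this
  digit, and the later digits cannot make up for more than half of it.
\<close>

lemma expansion_diff_ge:
  assumes v: "v \<in> digit_seqs" and w: "w \<in> digit_seqs"
    and eq: "\<forall>j<i. v j = w j" and neq: "v i \<noteq> w i"
  shows "1 / (2 * real (width i) ^ 4) \<le> \<bar>expansion v - expansion w\<bar>"
proof -
  define v' where "v' = v(i := w i)"
  have v': "v' \<in> digit_seqs"
    using v w by (simp add: v'_def digit_seqs_def)
  have "\<forall>j<Suc i. v' j = w j"
    using eq by (auto simp: v'_def less_Suc_eq)
  then have "\<bar>expansion v' - expansion w\<bar> \<le> 2 / real (width (Suc i)) ^ 3"
    by (rule expansion_diff_le[OF v' w])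
  also have "\<dots> \<le> 1 / (2 * real (width i) ^ 4)"
  proof -
    have "4 * real (width i) ^ 4 \<le> real (width i) ^ 2 * real (width i) ^ 4"
      using power_mono[of 2 "real (width i)" 2] width_ge_2[of i] by (intro mult_right_mono) auto
    then show ?thesis
      using width_pos[of i] by (simp add: width_Suc field_simps flip: power_mult power_add)
  qed
  finally have 1: "\<bar>expansion v' - expansion w\<bar> \<le> 1 / (2 * real (width i) ^ 4)" .
  have "expansion v' - expansion v = (real (w i) - real (v i)) / real (width i) ^ 4"
    using expansion_fun_upd[OF v, of "w i" i] w by (simp add: v'_def digit_seqs_def)
  then have "\<bar>expansion v' - expansion v\<bar> = \<bar>real (w i) - real (v i)\<bar> / real (width i) ^ 4"
    by (simp add: abs_divide)
  also have "\<dots> \<ge> 1 / real (width i) ^ 4"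
    using neq by (intro divide_right_mono) auto
  finally have "1 / real (width i) ^ 4 \<le> \<bar>expansion v' - expansion v\<bar>" .
  moreover have "1 / real (width i) ^ 4 = 1 / (2 * real (width i) ^ 4) + 1 / (2 * real (width i) ^ 4)"
    by simp
  ultimately show ?thesis
    using 1 by linarith
qed

lemma expansion_close_imp_eq:
  assumes v: "v \<in> digit_seqs" and w: "w \<in> digit_seqs"
    and close: "\<bar>expansion v - expansion w\<bar> < 1 / (2 * real (width i) ^ 4)" and "j \<le> i"
  shows "v j = w j"
  using \<open>j \<le> i\<close>
proof (induction j rule: less_induct)
  case (less j)
  show ?case
  proof (rule ccontr)
    assume "v j \<noteq> w j"
    then have "1 / (2 * real (width j) ^ 4) \<le> \<bar>expansion v - expansion w\<bar>"
      using less by (intro expansion_diff_ge[OF v w]) auto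
    moreover have "1 / (2 * real (width i) ^ 4) \<le> 1 / (2 * real (width j) ^ 4)"
      using width_mono[OF less.prems] width_pos[of j]
      by (intro divide_left_mono mult_left_mono power_mono) auto
    ultimately show False
      using close by linarith
  qed
qed

lemma compact_digit_seqs: "compact digit_seqs"
proof -
  have "compactin (product_topology (\<lambda>i. euclidean) UNIV) (\<Pi>\<^sub>E i\<in>UNIV. {..width i})"
    by (simp add: compactin_PiE finite_imp_compact)
  moreover have "digit_seqs = (\<Pi>\<^sub>E i\<in>UNIV. {..width i})"
    by (auto simp: digit_seqs_def PiE_iff)
  ultimately show ?thesis
    by (simp add: euclidean_product_topology)
qed

lemma continuous_on_expansion: "continuous_on digit_seqs expansion"
  unfolding continuous_on_def
proof (intro ballI tendstoI)
  fix v and \<epsilon> :: real assume v: "v \<in> digit_seqs" and "0 < \<epsilon>"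
  then obtain n where n: "2 / real (width n) ^ 3 < \<epsilon>"
    using width_cube_vanishes by blast
  have "open {w :: nat \<Rightarrow> nat. \<forall>j<n. w j = v j}"
    unfolding open_fun_nat_iff by (intro ballI exI[of _ n]) auto
  moreover have "dist (expansion w) (expansion v) < \<epsilon>" if "\<forall>j<n. w j = v j" "w \<in> digit_seqs" for w
    using expansion_diff_le[OF that(2) v that(1)] n by (simp add: dist_real_def)
  ultimately show "\<forall>\<^sub>F w in at v within digit_seqs. dist (expansion w) (expansion v) < \<epsilon>"
    unfolding eventually_at_topological by (intro exI[of _ "{w. \<forall>j<n. w j = v j}"]) auto
qed

text \<open>
  The support of the digit sequence is the set on which admissibility is imposed: the nonzero
  digits may take any value in their range.
\<close>

definition admissible_digits :: "(nat \<Rightarrow> nat) \<Rightarrow> (nat \<Rightarrow> nat) set" where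
  "admissible_digits x = {v \<in> digit_seqs. admissible x {i. v i \<noteq> 0}}"

definition coded_compact :: "(nat \<Rightarrow> nat) \<Rightarrow> 'a::euclidean_space set" where
  "coded_compact x = (\<lambda>v. expansion v *\<^sub>R (SOME b. b \<in> Basis)) ` admissible_digits x"

lemma dist_expansion_scaleR:
  "dist (expansion v *\<^sub>R (SOME b. b \<in> Basis) :: 'a::euclidean_space) (expansion w *\<^sub>R (SOME b. b \<in> Basis))
    = \<bar>expansion v - expansion w\<bar>"
proof -
  have "norm (SOME b :: 'a. b \<in> Basis) = 1"
    by (simp add: some_in_eq)
  then show ?thesis
    by (simp add: dist_norm scaleR_diff_left[symmetric])
qed

lemma closed_Collect_admissible: "closed {v :: nat \<Rightarrow> nat. admissible x {i. v i \<noteq> 0}}"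
proof -
  have "open (- {v :: nat \<Rightarrow> nat. admissible x {i. v i \<noteq> 0}})"
    unfolding open_fun_nat_iff
  proof
    fix v :: "nat \<Rightarrow> nat" assume "v \<in> - {v. admissible x {i. v i \<noteq> 0}}"
    then obtain i where i: "v i \<noteq> 0" "x (prefix_code x i {i. v i \<noteq> 0}) \<noteq> 0"
      by (auto simp: admissible_def)
    have "\<not> admissible x {i. w i \<noteq> 0}" if w: "\<forall>j<Suc i. w j = v j" for w
    proof -
      have "prefix_code x i {i. w i \<noteq> 0} = prefix_code x i {i. v i \<noteq> 0}"
        unfolding prefix_code_eq_iff using w by auto
      with i(2) have "x (prefix_code x i {i. w i \<noteq> 0}) \<noteq> 0"
        by (simp only: not_False_eq_True)
      moreover have "i \<in> {i. w i \<noteq> 0}"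
        using i(1) w by simp
      ultimately show ?thesis
        unfolding admissible_def by (metis (no_types))
    qed
    then show "\<exists>n. \<forall>w. (\<forall>j<n. w j = v j) \<longrightarrow> w \<in> - {v. admissible x {i. v i \<noteq> 0}}"
      by (intro exI[of _ "Suc i"]) auto
  qed
  then show ?thesis
    by (simp add: closed_def)
qed

lemma coded_compact_nonempty_compacts: "coded_compact x \<in> nonempty_compacts"
proof -
  have "compact (digit_seqs \<inter> {v. admissible x {i. v i \<noteq> 0}})"
    by (intro compact_Int_closed compact_digit_seqs closed_Collect_admissible)
  also have "digit_seqs \<inter> {v. admissible x {i. v i \<noteq> 0}} = admissible_digits x"
    by (auto simp: admissible_digits_def)
  finally have "compact (admissible_digits x)" .
  moreover have "continuous_on (admissible_digits x) expansion"
    by (rule continuous_on_subset[OF continuous_on_expansion]) (auto simp: admissible_digits_def)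
  ultimately have "compact (coded_compact x :: 'a set)"
    unfolding coded_compact_def
    by (intro compact_continuous_image continuous_on_scaleR continuous_on_const)
  moreover have "(\<lambda>_. 0) \<in> admissible_digits x"
    by (simp add: admissible_digits_def digit_seqs_def admissible_def)
  ultimately show ?thesis
    unfolding nonempty_compacts_def coded_compact_def by auto
qed

text \<open>
  Only finitely many codes concern subsets of \<open>{..<n}\<close>, so an initial segment of \<open>x\<close> decides which of
  them are admissible.
\<close>

lemma admissible_local:
  obtains M where "\<And>y A. \<lbrakk>\<forall>j<M. y j = x j; A \<subseteq> {..<n}\<rbrakk> \<Longrightarrow> admissible y A \<longleftrightarrow> admissible x A"
proof -
  have "finite ((\<lambda>(i, A). prefix_code x i A) ` ({..<n} \<times> Pow {..<n}))"
    by simp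
  then obtain M where "\<forall>c\<in>(\<lambda>(i, A). prefix_code x i A) ` ({..<n} \<times> Pow {..<n}). c < M"
    unfolding finite_nat_set_iff_bounded by blast
  then have M: "prefix_code x i A < M" if "i < n" "A \<subseteq> {..<n}" for i A
    using that by (auto dest!: bspec[of _ _ "prefix_code x i A"] intro!: image_eqI[of _ _ "(i, A)"])
  show ?thesis
  proof (rule that[of "max M n"])
    fix y A assume y: "\<forall>j<max M n. y j = x j" and A: "A \<subseteq> {..<n}"
    have "y (prefix_code y i A) = x (prefix_code x i A)" if "i \<in> A" for i
    proof -
      have "i < n"
        using A that by auto
      then have "prefix_code y i A = prefix_code x i A"
        unfolding prefix_code_eq_iff using y by auto
      then show ?thesis
        using y M[OF \<open>i < n\<close> A] by simp
    qed
    then show "admissible y A \<longleftrightarrow> admissible x A"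
      by (simp add: admissible_def)
  qed
qed

lemma admissible_Int_lessThan:
  assumes "admissible x A"
  shows "admissible x (A \<inter> {..<n})"
proof -
  have "prefix_code x i (A \<inter> {..<n}) = prefix_code x i A" if "i < n" for i
    unfolding prefix_code_eq_iff using that by auto
  then show ?thesis
    using assms by (simp add: admissible_def)
qed

text \<open>
  Truncating a digit sequence at \<open>n\<close> preserves admissibility and moves the point very little. So
  nearness of two coded sets in the Hausdorff metric only depends on the admissible subsets of
  \<open>{..<n}\<close>; without the truncation it would depend on which finite sets have admissible extensions,
  which is not decided by finitely many values of \<open>x\<close>.
\<close>

lemma coded_compact_infdist_le:
  fixes x y :: "nat \<Rightarrow> nat"
  assumes initial: "\<And>A. A \<subseteq> {..<n} \<Longrightarrow> admissible x A \<Longrightarrow> admissible y A"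
    and a: "a \<in> (coded_compact x :: 'a::euclidean_space set)"
  shows "infdist a (coded_compact y) \<le> 2 / real (width n) ^ 3"
proof -
  obtain v where v: "v \<in> digit_seqs" "admissible x {i. v i \<noteq> 0}"
      and a_eq: "a = expansion v *\<^sub>R (SOME b. b \<in> Basis)"
    using a by (auto simp: coded_compact_def admissible_digits_def)
  define w where "w i = (if i < n then v i else 0)" for i
  have w: "w \<in> digit_seqs"
    using v(1) by (simp add: w_def digit_seqs_def)
  have "{i. w i \<noteq> 0} = {i. v i \<noteq> 0} \<inter> {..<n}"
    by (auto simp: w_def)
  then have "admissible y {i. w i \<noteq> 0}"
    using initial admissible_Int_lessThan[OF v(2)] by simp
  with w have "infdist a (coded_compact y) \<le> dist a (expansion w *\<^sub>R (SOME b. b \<in> Basis))"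
    by (intro infdist_le) (auto simp: coded_compact_def admissible_digits_def)
  also have "\<dots> \<le> 2 / real (width n) ^ 3"
    unfolding a_eq dist_expansion_scaleR by (rule expansion_diff_le[OF v(1) w]) (simp add: w_def)
  finally show ?thesis .
qed

text \<open>
  The map is even continuous: by the two preceding ideas, sequences with a long common initial segment
  have coded sets that are close in the Hausdorff metric.
\<close>

lemma coded_compact_measurable:
  "(coded_compact :: _ \<Rightarrow> 'a::euclidean_space set) \<in> measurable borel hausdorff_borel"
  unfolding hausdorff_borel_def
proof (rule measurable_measure_of)
  interpret H: Metric_space "nonempty_compacts :: 'a set set" hausdorff_dist
    by (rule Metric_space_hausdorff)
  show "{U. openin H.mtopology U} \<subseteq> Pow (nonempty_compacts :: 'a set set)"
    by (auto simp: H.openin_mtopology)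
  show "(coded_compact :: _ \<Rightarrow> 'a set) \<in> space borel \<rightarrow> nonempty_compacts"
    using coded_compact_nonempty_compacts by auto
  fix U assume "U \<in> {U. openin H.mtopology U}"
  then have U: "openin H.mtopology U"
    by simp
  have "open ((coded_compact :: _ \<Rightarrow> 'a set) -` U)"
    unfolding open_fun_nat_iff
  proof
    fix x assume "x \<in> (coded_compact :: _ \<Rightarrow> 'a set) -` U"
    then obtain r where r: "0 < r" "H.mball (coded_compact x) r \<subseteq> U"
      using U by (auto simp: H.openin_mtopology)
    obtain n where n: "2 / real (width n) ^ 3 < r"
      using width_cube_vanishes[OF r(1)] by blast
    obtain M where M: "\<And>y A. \<lbrakk>\<forall>j<M. y j = x j; A \<subseteq> {..<n}\<rbrakk> \<Longrightarrow> admissible y A \<longleftrightarrow> admissible x A"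
      using admissible_local by blast
    have "coded_compact y \<in> U" if y: "\<forall>j<M. y j = x j" for y
    proof -
      have "hausdorff_dist (coded_compact x :: 'a set) (coded_compact y) \<le> 2 / real (width n) ^ 3"
        unfolding hausdorff_dist_le_iff[OF coded_compact_nonempty_compacts coded_compact_nonempty_compacts]
        using M[OF y] by (intro conjI ballI coded_compact_infdist_le) auto
      then have "coded_compact y \<in> H.mball (coded_compact x) r"
        using n by (simp add: H.in_mball coded_compact_nonempty_compacts)
      then show ?thesis
        using r(2) by blast
    qed
    then show "\<exists>M. \<forall>y. (\<forall>j<M. y j = x j) \<longrightarrow> y \<in> (coded_compact :: _ \<Rightarrow> 'a set) -` U"
      by blast
  qed
  then show "(coded_compact :: _ \<Rightarrow> 'a set) -` U \<inter> space borel \<in> sets borel"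
    by simp
qed

section \<open>The dimension detects infinite admissible sets\<close>

lemma countable_finite_support: "countable {v :: nat \<Rightarrow> nat. finite {i. v i \<noteq> 0}}"
proof -
  have "{v :: nat \<Rightarrow> nat. finite {i. v i \<noteq> 0}}
      \<subseteq> range (\<lambda>xs i. if i < length xs then xs ! i else 0)"
  proof
    fix v :: "nat \<Rightarrow> nat" assume "v \<in> {v. finite {i. v i \<noteq> 0}}"
    then obtain n where n: "\<And>i. v i \<noteq> 0 \<Longrightarrow> i < n"
      using finite_nat_set_iff_bounded by auto
    then have "v = (\<lambda>i. if i < length (map v [0..<n]) then map v [0..<n] ! i else 0)"
      by fastforce
    then show "v \<in> range (\<lambda>xs i. if i < length xs then xs ! i else 0)"
      by (rule range_eqI)
  qed
  then show ?thesis
    by (rule countable_subset) simp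
qed

text \<open>
  If all admissible sets are finite, then all digit sequences have finite support, and the coded set
  is countable.
\<close>

lemma universal_dim_coded_compact_eq_0:
  assumes "\<not> (\<exists>A. infinite A \<and> admissible x A)"
  shows "universal_dim (coded_compact x :: 'a::euclidean_space set) = 0"
proof (rule universal_dim_countable)
  have "admissible_digits x \<subseteq> {v. finite {i. v i \<noteq> 0}}"
    using assms by (auto simp: admissible_digits_def)
  then have "countable (admissible_digits x)"
    using countable_finite_support by (rule countable_subset)
  then show "countable (coded_compact x :: 'a set)"
    by (simp add: coded_compact_def)
qed

text \<open>
  The upper bounds \<open>1 / (2 * width i ^ 4)\<close> are the distances below which the digits up to \<open>i\<close> agree;
  a set whose diameter lies in the \<open>i\<close>-th interval therefore meets a coded set in points with the
  same digit \<open>i\<close>.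
\<close>

definition separation_scales :: "nat set \<Rightarrow> real set" where
  "separation_scales A = (\<Union>i\<in>A. {1 / (4 * real (width i) ^ 4)..<1 / (2 * real (width i) ^ 4)})"

lemma separation_scales_in_scale_sets:
  assumes "infinite A"
  shows "separation_scales A \<in> scale_sets"
proof -
  have pos: "0 < 1 / (4 * real (width i) ^ 4)" for i
    using width_pos[of i] by simp
  have mem: "1 / (4 * real (width i) ^ 4) \<in> separation_scales A" if "i \<in> A" for i
    using that width_pos[of i] by (auto simp: separation_scales_def field_simps intro!: bexI[of _ i])
  have sub: "separation_scales A \<subseteq> {0<..}"
    using pos by (fastforce simp: separation_scales_def)
  have ne: "separation_scales A \<noteq> {}"
    using assms mem by (metis empty_iff finite.emptyI equals0I)
  have "Inf (separation_scales A) = 0"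
  proof (rule cInf_eq_non_empty[OF ne])
    fix y assume y: "\<And>t. t \<in> separation_scales A \<Longrightarrow> y \<le> t"
    show "y \<le> 0"
    proof (rule ccontr)
      assume "\<not> y \<le> 0"
      then obtain n where n: "2 / real (width n) ^ 3 < y"
        using width_cube_vanishes[of y] by auto
      obtain i where i: "i \<in> A" "n \<le> i"
        using assms by (meson infinite_nat_iff_unbounded_le)
      have "1 * real (width n) ^ 3 \<le> 4 * real (width i) * real (width i) ^ 3"
        using width_mono[OF i(2)] width_pos[of i] by (intro mult_mono power_mono) auto
      then have "1 / (4 * real (width i) ^ 4) \<le> 1 / real (width n) ^ 3"
        using width_pos by (intro divide_left_mono) (auto simp: eval_nat_numeral)
      moreover have "0 < 1 / real (width n) ^ 3"
        using width_pos[of n] by simp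
      ultimately show False
        using y[OF mem[OF i(1)]] n by linarith
    qed
  qed (use sub in auto)
  moreover have "openin sorgenfrey (separation_scales A)"
    unfolding openin_sorgenfrey_iff
  proof
    fix t assume "t \<in> separation_scales A"
    then obtain i where i: "i \<in> A" "1 / (4 * real (width i) ^ 4) \<le> t" "t < 1 / (2 * real (width i) ^ 4)"
      by (auto simp: separation_scales_def)
    then have "{t..<t + (1 / (2 * real (width i) ^ 4) - t)} \<subseteq> separation_scales A"
      by (force simp: separation_scales_def)
    then show "\<exists>\<delta>>0. {t..<t + \<delta>} \<subseteq> separation_scales A"
      using i(3) by (intro exI[of _ "1 / (2 * real (width i) ^ 4) - t"]) auto
  qed
  ultimately show ?thesis
    using sub ne by (simp add: scale_sets_def)
qed

text \<open>
  For \<open>u\<close> uniformly distributed in \<open>{0..<1}\<close>, each digit in a position of \<open>A\<close> is uniformly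
  distributed over \<open>{1..width i}\<close>. The digits are highly dependent; only their individual
  distributions matter. They start at 1 because the support has to be exactly \<open>A\<close>.
\<close>

definition uniform_digits :: "nat set \<Rightarrow> real \<Rightarrow> nat \<Rightarrow> nat" where
  "uniform_digits A u i = (if i \<in> A then Suc (nat \<lfloor>u * width i\<rfloor>) else 0)"

lemma uniform_digits_in_admissible_digits:
  assumes "admissible x A" "u \<in> {0..<1}"
  shows "uniform_digits A u \<in> admissible_digits x"
proof -
  have "uniform_digits A u i \<le> width i" for i
  proof -
    have "u * width i < width i"
      using assms(2) width_pos[of i] by simp
    then have "\<lfloor>u * width i\<rfloor> < int (width i)"
      by (simp add: floor_less_iff)
    then show ?thesis
      using width_pos[of i] by (auto simp: uniform_digits_def)
  qed
  moreover have "{i. uniform_digits A u i \<noteq> 0} = A"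
    by (auto simp: uniform_digits_def)
  ultimately show ?thesis
    using assms(1) by (simp add: admissible_digits_def digit_seqs_def)
qed

text \<open>
  A mass distribution argument with the image of the Lebesgue measure on \<open>{0..<1}\<close> under
  \<open>uniform_digits A\<close>. A set whose diameter is one of the separation scales of \<open>i\<close> fixes the digit
  \<open>i\<close>, hence has mass at most \<open>1 / width i\<close>; as its diameter is at least \<open>1 / (4 * width i ^ 4)\<close>, which
  is at least \<open>1 / width i ^ 6\<close>, the mass is at most the diameter to the power \<open>1/6\<close>. The total mass
  is 1. Instead of the image measure, the proof measures the sets of parameters \<open>u\<close> directly.
\<close>

lemma restricted_content_coded_compact_ge_1:
  assumes adm: "admissible x A" and s: "0 \<le> s" "s \<le> 1/6"
  shows "1 \<le> restricted_content (separation_scales A) s (coded_compact x :: 'a::euclidean_space set)"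
  unfolding restricted_content_def
proof (rule INF_greatest)
  fix C :: "nat \<Rightarrow> 'a set"
  assume "C \<in> {C. coded_compact x \<subseteq> (\<Union>i. C i) \<and>
      (\<forall>i. bounded (C i) \<and> diameter (C i) \<in> separation_scales A)}"
  then have cover: "coded_compact x \<subseteq> (\<Union>i. C i)" and bdd: "\<And>m. bounded (C m)"
    and diam: "\<And>m. diameter (C m) \<in> separation_scales A"
    by auto
  define pt :: "real \<Rightarrow> 'a" where "pt u = expansion (uniform_digits A u) *\<^sub>R (SOME b. b \<in> Basis)" for u
  have pt: "pt u \<in> coded_compact x" if "u \<in> {0..<1}" for u
    unfolding pt_def coded_compact_def
    by (rule imageI) (rule uniform_digits_in_admissible_digits[OF adm that])
  have digits: "uniform_digits A u \<in> digit_seqs" if "u \<in> {0..<1}" for u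
    using uniform_digits_in_admissible_digits[OF adm that] by (simp add: admissible_digits_def)
  have "\<exists>J. J \<in> sets lborel \<and> {u \<in> {0..<1}. pt u \<in> C m} \<subseteq> J \<and>
      emeasure lborel J \<le> ennreal (diameter (C m) powr s)" for m
  proof -
    obtain i where i: "i \<in> A" "1 / (4 * real (width i) ^ 4) \<le> diameter (C m)"
        "diameter (C m) < 1 / (2 * real (width i) ^ 4)"
      using diam[of m] by (auto simp: separation_scales_def)
    have same: "\<lfloor>u * width i\<rfloor> = \<lfloor>t * width i\<rfloor>"
      if u: "u \<in> {0..<1}" "pt u \<in> C m" and t: "t \<in> {0..<1}" "pt t \<in> C m" for u t
    proof -
      have "dist (pt u) (pt t) \<le> diameter (C m)"
        using diameter_bounded_bound[OF bdd u(2) t(2)] .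
      then have "\<bar>expansion (uniform_digits A u) - expansion (uniform_digits A t)\<bar> < 1 / (2 * real (width i) ^ 4)"
        using i(3) by (simp add: pt_def dist_expansion_scaleR)
      then have "uniform_digits A u i = uniform_digits A t i"
        by (rule expansion_close_imp_eq[OF digits[OF u(1)] digits[OF t(1)]]) simp
      moreover have "0 \<le> \<lfloor>u * width i\<rfloor>" "0 \<le> \<lfloor>t * width i\<rfloor>"
        using u(1) t(1) by auto
      ultimately show ?thesis
        using i(1) by (simp add: uniform_digits_def eq_nat_nat_iff)
    qed
    obtain k :: int where k: "\<And>u. \<lbrakk>u \<in> {0..<1}; pt u \<in> C m\<rbrakk> \<Longrightarrow> \<lfloor>u * width i\<rfloor> = k"
      using same by metis
    let ?J = "{k / width i..<(k + 1) / width i}"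
    have "{u \<in> {0..<1}. pt u \<in> C m} \<subseteq> ?J"
    proof
      fix u assume "u \<in> {u \<in> {0..<1}. pt u \<in> C m}"
      then have "\<lfloor>u * width i\<rfloor> = k"
        using k by auto
      then have "k \<le> u * width i" "u * width i < k + 1"
        by linarith+
      then show "u \<in> ?J"
        using width_pos[of i] by (simp add: field_simps)
    qed
    moreover have "emeasure lborel ?J = ennreal (1 / width i)"
      using width_pos[of i] by (simp add: emeasure_lborel_Ico divide_right_mono diff_divide_distrib[symmetric])
    moreover have "1 / width i \<le> diameter (C m) powr s"
    proof -
      have w: "2 \<le> real (width i)"
        using width_ge_2[of i] by simp
      \<comment> \<open>The bound is wanted for all \<open>s \<le> 1/6\<close>; passing to \<open>q\<close>, which is at most both 1 and the
        diameter, reduces it to the exponent \<open>1/6\<close>.\<close>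
      define q where "q = 1 / real (width i) ^ 6"
      have q: "0 < q" "q \<le> 1"
        using w by (auto simp: q_def)
      have "1 / width i = q powr (1/6)"
      proof -
        have "(1 / width i) powr 6 = q"
          using w by (simp add: q_def power_divide)
        moreover have "((1 / width i) powr 6) powr (1/6) = 1 / width i"
          using w by (simp only: powr_powr) simp
        ultimately show ?thesis
          by simp
      qed
      also have "\<dots> \<le> q powr s"
        using q s by (intro powr_mono') auto
      also have "\<dots> \<le> diameter (C m) powr s"
      proof (rule powr_mono2)
        have "4 * real (width i) ^ 4 \<le> real (width i) ^ 2 * real (width i) ^ 4"
          using power_mono[of 2 "real (width i)" 2] w by (intro mult_right_mono) auto
        then have "q \<le> 1 / (4 * real (width i) ^ 4)"
          unfolding q_def using w by (intro divide_left_mono) (auto simp flip: power_add)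
        then show "q \<le> diameter (C m)"
          using i(2) by linarith
      qed (use q s in auto)
      finally show ?thesis .
    qed
    ultimately show ?thesis
      by (intro exI[of _ ?J]) (auto intro: ennreal_leI)
  qed
  then obtain J where J: "\<And>m. J m \<in> sets lborel" "\<And>m. {u \<in> {0..<1}. pt u \<in> C m} \<subseteq> J m"
      "\<And>m. emeasure lborel (J m) \<le> ennreal (diameter (C m) powr s)"
    by metis
  have "1 = emeasure lborel {0..<1 :: real}"
    by simp
  also have "\<dots> \<le> emeasure lborel (\<Union>m. J m)"
  proof (rule emeasure_mono)
    show "{0..<1} \<subseteq> (\<Union>m. J m)"
    proof
      fix u :: real assume u: "u \<in> {0..<1}"
      then obtain m where "pt u \<in> C m"
        using cover pt by blast
      with u J(2)[of m] show "u \<in> (\<Union>m. J m)"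
        by blast
    qed
  qed (use J(1) in auto)
  also have "\<dots> \<le> (\<Sum>m. emeasure lborel (J m))"
    using J(1) by (intro emeasure_subadditive_countably) auto
  also have "\<dots> \<le> (\<Sum>m. ennreal (diameter (C m) powr s))"
    by (intro suminf_le J(3)) auto
  finally show "1 \<le> (\<Sum>m. ennreal (diameter (C m) powr s))" .
qed

lemma universal_dim_coded_compact_pos:
  assumes "infinite A" "admissible x A"
  shows "0 < universal_dim (coded_compact x :: 'a::euclidean_space set)"
proof -
  have "ennreal (1/6) \<le> restricted_dim (separation_scales A) (coded_compact x :: 'a set)"
    unfolding restricted_dim_def
  proof (rule INF_greatest)
    fix s assume s: "s \<in> {s. 0 \<le> s \<and> restricted_content (separation_scales A) s (coded_compact x :: 'a set) = 0}"
    have "\<not> s \<le> 1/6"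
    proof
      assume "s \<le> 1/6"
      with s have "1 \<le> restricted_content (separation_scales A) s (coded_compact x :: 'a set)"
        by (intro restricted_content_coded_compact_ge_1[OF assms(2)]) auto
      with s show False
        by simp
    qed
    then show "ennreal (1/6) \<le> ennreal s"
      by (intro ennreal_leI) simp
  qed
  also have "\<dots> \<le> universal_dim (coded_compact x :: 'a set)"
    unfolding universal_dim_def by (rule SUP_upper) (rule separation_scales_in_scale_sets[OF assms(1)])
  finally show ?thesis
    using order_less_le_trans[of 0 "ennreal (1/6)"] by simp
qed

text \<open>
  If the dimension were Borel, so would be its zero set, and hence the set of all \<open>x\<close> whose coded set
  has dimension 0; but those are the \<open>x\<close> without infinite admissible sets.
\<close>

theorem universal_dim_not_borel:
  "(universal_dim :: 'a::euclidean_space set \<Rightarrow> ennreal) \<notin> measurable hausdorff_borel borel"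
proof
  assume "(universal_dim :: 'a set \<Rightarrow> ennreal) \<in> measurable hausdorff_borel borel"
  with coded_compact_measurable
  have "(\<lambda>x. universal_dim (coded_compact x :: 'a set)) \<in> borel_measurable borel"
    by (rule measurable_compose)
  then have "(\<lambda>x. universal_dim (coded_compact x :: 'a set)) -` {0} \<inter> space borel \<in> sets borel"
    by (rule measurable_sets) simp
  moreover have "(\<lambda>x. universal_dim (coded_compact x :: 'a set)) -` {0} =
      {x. \<not> (\<exists>A. infinite A \<and> admissible x A)}"
  proof (intro set_eqI iffI)
    fix x assume "x \<in> (\<lambda>x. universal_dim (coded_compact x :: 'a set)) -` {0}"
    then have "\<not> 0 < universal_dim (coded_compact x :: 'a set)"
      by simp
    then show "x \<in> {x. \<not> (\<exists>A. infinite A \<and> admissible x A)}"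
      using universal_dim_coded_compact_pos by blast
  next
    fix x assume "x \<in> {x. \<not> (\<exists>A. infinite A \<and> admissible x A)}"
    then show "x \<in> (\<lambda>x. universal_dim (coded_compact x :: 'a set)) -` {0}"
      using universal_dim_coded_compact_eq_0 by simp
  qed
  ultimately have "analytic_set {x. \<not> (\<exists>A. infinite A \<and> admissible x A)}"
    by (intro borel_imp_analytic_set metrizable_space_fun_nat) simp
  then show False
    using not_analytic_set_no_infinite_admissible by blast
qed

theorem theorem4p11:
  shows "(universal_dim :: (real ^ 'n) set \<Rightarrow> ennreal)
      \<in> nonempty_compacts \<rightarrow> {0..of_nat CARD('n)} \<and>
    (universal_dim :: (real ^ 'n) set \<Rightarrow> ennreal)
      \<notin> measurable hausdorff_borel (restrict_space borel {0..of_nat CARD('n)})"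
proof
  show "(universal_dim :: (real ^ 'n) set \<Rightarrow> ennreal) \<in> nonempty_compacts \<rightarrow> {0..of_nat CARD('n)}"
  proof
    fix K :: "(real ^ 'n) set" assume "K \<in> nonempty_compacts"
    then have "universal_dim K \<le> of_nat DIM(real ^ 'n)"
      by (intro universal_dim_le_DIM compact_imp_bounded) (simp add: nonempty_compacts_def)
    then show "universal_dim K \<in> {0..of_nat CARD('n)}"
      by simp
  qed
  show "(universal_dim :: (real ^ 'n) set \<Rightarrow> ennreal)
      \<notin> measurable hausdorff_borel (restrict_space borel {0..of_nat CARD('n)})"
    using universal_dim_not_borel[where ?'a = "real ^ 'n"]
    by (simp add: measurable_restrict_space2_iff)
qed

end
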